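(* Let $1\le d_1\le d_2$, let $\mathcal{K}_{\ell_{\mathrm{spec}}}\subset\mathbb{R}\times\mathbb{R}^{d_1\times d_2}$ be the spectral norm cone with barrier $F$, and let $G^\ast$ be its conjugate gradient (all defined in the context). Let $(p,R)\in\operatorname{int}(\mathcal{K}_{\ell_{\mathrm{spec}}}^\ast)$ and let $R=U_R\operatorname{Diag}(\sigma_R)V_R^\top$ be the singular value decomposition of $R$. Then the components of $G^\ast=G^\ast(p,R)$ are $$G^\ast_p=g^\ast_p(p,\sigma_R),\qquad G^\ast_R=U_R\operatorname{Diag}(g^\ast_r(p,\sigma_R))V_R^\top,$$ where $g^\ast$ is the conjugate gradient of the infinity norm cone $\mathcal{K}_{\ell_\infty}\subset\mathbb{R}\times\mathbb{R}^{d_1}$ with its barrier $f$.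
   Context: For a closed, convex, pointed, full-dimensional cone $\mathcal{K}$ in a finite-dimensional real inner product space, the dual cone is $\mathcal{K}^\ast=\{s:\langle w,s\rangle\ge 0\ \forall w\in\mathcal{K}\}$. Given a barrier function $f:\operatorname{int}(\mathcal{K})\to\mathbb{R}$, the conjugate barrier is $f^\ast(s)=\sup_{w\in\operatorname{int}(\mathcal{K})}\{-\langle s,w\rangle-f(w)\}$ for $s\in\operatorname{int}(\mathcal{K}^\ast)$, and the conjugate gradient $g^\ast$ is the gradient of $f^\ast$; equivalently $g^\ast(s)=-\operatorname{argsup}_{w\in\operatorname{int}(\mathcal{K})}\{-\langle s,w\rangle-f(w)\}$. The standard (trace, for matrices) inner product is used. The infinity norm cone in dimension $d_1$ is $\mathcal{K}_{\ell_\infty}=\{(u,w)\in\mathbb{R}\times\mathbb{R}^{d_1}:u\ge\|w\|_\infty\}$ with barrier $f(u,w)=-\sum_{i=1}^{d_1}\log(u^2-w_i^2)+(d_1-1)\log(u)$ and dual cone $\{(p,r):p\ge\|r\|_1\}$; the components of its conjugate gradient at $(p,r)$ are $g^\ast_p$ and $g^\ast_r$. The spectral norm cone is $\mathcal{K}_{\ell_{\mathrm{spec}}}=\{(u,W)\in\mathbb{R}\times\mathbb{R}^{d_1\times d_2}:u\ge\sigma_{\max}(W)\}$, where $\sigma_{\max}$ is the maximum singular value. Its dual cone is $\mathcal{K}_{\ell_{\mathrm{spec}}}^\ast=\{(p,R)\in\mathbb{R}\times\mathbb{R}^{d_1\times d_2}:p\ge\sum_{i=1}^{d_1}\sigma_{R,i}\}$,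 and its barrier is $F(u,W)=f(u,\sigma_W)=-\sum_{i=1}^{d_1}\log(u^2-\sigma_{W,i}^2)+(d_1-1)\log(u)$. Here for $W\in\mathbb{R}^{d_1\times d_2}$ the (thin) singular value decomposition is $W=U_W\operatorname{Diag}(\sigma_W)V_W^\top$ with $\sigma_W\in\mathbb{R}^{d_1}_+$ the vector of singular values, $U_W\in\mathbb{R}^{d_1\times d_1}$ orthogonal, and $V_W\in\mathbb{R}^{d_2\times d_1}$ with orthonormal columns. *)

theory Defs
  imports "HOL-Analysis.Analysis"
begin

section \<open>Dual cones and conjugate barriers\<close>

definition dual_cone :: "'a::real_inner set \<Rightarrow> 'a set" where
  "dual_cone K = {s. \<forall>w\<in>K. w \<bullet> s \<ge> 0}"

text \<open>The real-valued supremum is the intended one where the set of values is bounded above;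
  for the barriers below this holds at every point of the interior of the dual cone.\<close>

definition conj_barrier :: "'a::real_inner set \<Rightarrow> ('a \<Rightarrow> real) \<Rightarrow> 'a \<Rightarrow> real" where
  "conj_barrier K f s = (SUP w\<in>interior K. - (s \<bullet> w) - f w)"

definition gradient :: "('a::real_inner \<Rightarrow> real) \<Rightarrow> 'a \<Rightarrow> 'a" where
  "gradient f x = (THE D. GDERIV f x :> D)"

definition conj_grad :: "'a::real_inner set \<Rightarrow> ('a \<Rightarrow> real) \<Rightarrow> 'a \<Rightarrow> 'a" where
  "conj_grad K f = gradient (conj_barrier K f)"

section \<open>The infinity norm cone\<close>

definition linf_cone :: "(real \<times> (real^'m)) set" where
  "linf_cone = {(u, w). u \<ge> infnorm w}"

definition linf_barrier :: "real \<times> (real^'m) \<Rightarrow> real" where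
  "linf_barrier = (\<lambda>(u, w).
     - (\<Sum>i\<in>UNIV. ln (u\<^sup>2 - (w $ i)\<^sup>2)) + (real CARD('m) - 1) * ln u)"

section \<open>Thin singular value decompositions and the spectral norm cone\<close>

definition diag_mat :: "real^'m \<Rightarrow> real^'m^'m" where
  "diag_mat s = (\<chi> i j. if i = j then s $ i else 0)"

text \<open>A matrix with row index type \<^typ>\<open>'m\<close> and column index type \<^typ>\<open>'n\<close> has type
  \<^typ>\<open>real^'n^'m\<close>, and the inner product of that type is the trace inner product. The condition on
  \<open>V\<close> says that its columns are orthonormal, which forces \<open>CARD('m) \<le> CARD('n)\<close>.
  The index type carries no order, so the singular values are not required to be sorted.\<close>

definition thin_svd :: "real^'n^'m \<Rightarrow> real^'m^'m \<Rightarrow> real^'m \<Rightarrow> real^'m^'n \<Rightarrow> bool" where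
  "thin_svd W U s V \<longleftrightarrow>
     orthogonal_matrix U \<and> transpose V ** V = mat 1 \<and> (\<forall>i. s $ i \<ge> 0) \<and>
     W = U ** diag_mat s ** transpose V"

text \<open>The vector of singular values is determined only up to a permutation of its entries; the two
  functions applied to it below, the maximum and \<^const>\<open>linf_barrier\<close>, do not depend on the
  order of the entries.\<close>

definition singular_values :: "real^'n^'m \<Rightarrow> real^'m" where
  "singular_values W = (SOME s. \<exists>U V. thin_svd W U s V)"

definition max_singular_value :: "real^'n^'m \<Rightarrow> real" where
  "max_singular_value W = Max (range (\<lambda>i. singular_values W $ i))"

definition spec_cone :: "(real \<times> (real^'n^'m)) set" where
  "spec_cone = {(u, W). u \<ge> max_singular_value W}"

definition spec_barrier :: "real \<times> (real^'n^'m) \<Rightarrow> real" where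
  "spec_barrier = (\<lambda>(u, W). linf_barrier (u, singular_values W))"

end

theory Submission
  imports Defs
begin

text \<open>
  The conjugate gradient is minus the minimiser of \<open>w \<mapsto> s \<bullet> w + f w\<close> over the interior of the cone. It
  therefore suffices to find the minimisers for the two barriers, to see that they correspond, and to
  know that the conjugates are differentiable. Both cones are treated by one explicit computation.

  For a matrix \<open>X\<close> whose rows \<open>x\<^sub>i\<close> lie in some inner product space, let the row norm barrier be the
  infinity norm barrier applied to the norms of the rows. Its objective for \<open>(p, r)\<close> has a closed form
  minimiser: \<open>u = 1 / t\<close>, where \<open>t\<close> is a positive root of \<open>t + (\<Sum>i. sqrt (t\<^sup>2 + (norm r\<^sub>i)\<^sup>2)) = p\<close>,
  and \<open>x\<^sub>i\<close> is a negative multiple of \<open>r\<^sub>i\<close> whose factor depends only on \<open>t\<close> and the norm of \<open>r\<^sub>i\<close>. The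
  objective exceeds its minimum by at least a constant times \<open>N\<^sup>2 / (1 + N)\<close> at distance \<open>N\<close> from the
  minimiser (\<open>row_norm_barrier_growth\<close>), and this growth alone makes the conjugate differentiable
  with the expected gradient (\<open>conj_grad_eq_uminus_minimiser\<close>).

  With one-dimensional rows and \<open>r = sigma\<close> this is the infinity norm cone. For the spectral norm cone,
  let \<open>r\<close> be \<open>transpose U ** R\<close>, whose rows are the singular values of \<open>R\<close> times orthonormal vectors.
  The rotation \<open>W \<mapsto> transpose U ** W\<close> preserves pairings and distances, and it does not increase the
  barrier: the row norm barrier of the rotated matrix is at most the spectral norm barrier of \<open>W\<close>
  (\<open>row_norm_barrier_le_spec_barrier\<close>), because squared row norms are doubly stochastic averages of squared
  singular values and the logarithm is concave. At the rotated-back minimiser there is equality, since its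
  rows after rotation are already orthogonal. So the growth bound carries over from the row norm barrier
  to the spectral norm barrier, with the minimiser \<open>U ** diag_mat w ** transpose V\<close>, where
  \<open>(1 / t, w)\<close> is the minimiser for the infinity norm cone.

  The singular values that enter the spectral norm barrier exist by \<open>thin_svd_exists\<close>, which is proved
  by maximising a weighted sum of squared row norms over the orthogonal matrices.
\<close>

section \<open>The gradient of a conjugate barrier at a strict minimiser\<close>

text \<open>The penalty dominates as soon as \<open>N\<close> exceeds \<open>2 * D / \<kappa>\<close>; below that the linear term is
  small by itself.\<close>
lemma penalised_linear_growth_le:
  fixes D N \<kappa> :: real
  assumes "0 \<le> D" "0 \<le> N" "0 < \<kappa>" "D \<le> \<kappa> / 2"
  shows "D * N - \<kappa> * N\<^sup>2 / (1 + N) \<le> 2 * D\<^sup>2 / \<kappa>"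
proof (cases "N \<le> 2 * D / \<kappa>")
  case True
  have "D * N \<le> D * (2 * D / \<kappa>)"
    using True assms(1) by (intro mult_left_mono)
  moreover have "0 \<le> \<kappa> * N\<^sup>2 / (1 + N)"
    using assms by simp
  moreover have "D * (2 * D / \<kappa>) = 2 * D\<^sup>2 / \<kappa>"
    by (simp add: power2_eq_square)
  ultimately show ?thesis by linarith
next
  case False
  then have "2 * D < \<kappa> * N"
    using assms by (simp add: field_simps)
  moreover have "D * N \<le> \<kappa> / 2 * N"
    using assms by (intro mult_right_mono)
  ultimately have "D * (1 + N) \<le> \<kappa> * N"
    by (simp add: algebra_simps)
  then have "N * (D * (1 + N)) \<le> N * (\<kappa> * N)"
    using assms(2) by (rule mult_left_mono)
  then have "D * N \<le> \<kappa> * N\<^sup>2 / (1 + N)"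
    using assms(2) by (simp add: pos_le_divide_eq power2_eq_square algebra_simps)
  moreover have "0 \<le> 2 * D\<^sup>2 / \<kappa>"
    using assms by simp
  ultimately show ?thesis by linarith
qed

text \<open>The envelope theorem, with growth in place of smoothness: moving
  \<open>s\<close> away from \<open>s0\<close> by \<open>D\<close> in norm tilts the objective at distance \<open>N\<close> from \<open>w0\<close> by at most
  \<open>D * N\<close> relative to \<open>w0\<close>, and the growth bound outweighs this up to an error quadratic in \<open>D\<close>. So the
  conjugate stays within \<open>O(D\<^sup>2)\<close> of the affine function \<open>\<lambda>s. - (s \<bullet> w0) - f w0\<close>, which
  supports it from below. The bound is quadratic near \<open>w0\<close> and linear far away because
  the objective of a logarithmic barrier is linear at infinity up to logarithms.\<close>
lemma conj_grad_eq_uminus_minimiser: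
  fixes f :: "'a::real_inner \<Rightarrow> real"
  assumes w0: "w0 \<in> interior K" and \<kappa>: "0 < \<kappa>"
    and gap: "\<And>w. w \<in> interior K \<Longrightarrow>
      s0 \<bullet> w0 + f w0 + \<kappa> * (norm (w - w0))\<^sup>2 / (1 + norm (w - w0)) \<le> s0 \<bullet> w + f w"
  shows "conj_grad K f s0 = - w0"
proof -
  define \<phi> where "\<phi> = conj_barrier K f"
  have upper: "- (s \<bullet> w) - f w \<le> - (s \<bullet> w0) - f w0 + 2 * (norm (s - s0))\<^sup>2 / \<kappa>"
    if s: "norm (s - s0) \<le> \<kappa> / 2" and w: "w \<in> interior K" for s w
  proof -
    have "- ((s - s0) \<bullet> (w - w0)) \<le> norm (s - s0) * norm (w - w0)"
      using Cauchy_Schwarz_ineq2[of "s - s0" "w - w0"] by linarith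
    moreover have "norm (s - s0) * norm (w - w0) - \<kappa> * (norm (w - w0))\<^sup>2 / (1 + norm (w - w0))
        \<le> 2 * (norm (s - s0))\<^sup>2 / \<kappa>"
      using s \<kappa> by (intro penalised_linear_growth_le) auto
    moreover have "s \<bullet> w = s0 \<bullet> w + (s - s0) \<bullet> w0 + (s - s0) \<bullet> (w - w0)"
      "s \<bullet> w0 = s0 \<bullet> w0 + (s - s0) \<bullet> w0"
      by (simp_all add: inner_diff_left inner_diff_right)
    ultimately show ?thesis
      using gap[OF w] by linarith
  qed
  have lower: "- (s \<bullet> w0) - f w0 \<le> \<phi> s"
    if "norm (s - s0) \<le> \<kappa> / 2" for s
    unfolding \<phi>_def conj_barrier_def
    using upper[OF that] w0 by (intro cSUP_upper bdd_aboveI2) auto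
  have sup_le: "\<phi> s \<le> - (s \<bullet> w0) - f w0 + 2 * (norm (s - s0))\<^sup>2 / \<kappa>"
    if "norm (s - s0) \<le> \<kappa> / 2" for s
    unfolding \<phi>_def conj_barrier_def
    using upper[OF that] w0 by (intro cSUP_least) auto
  have attained: "\<phi> s0 = - (s0 \<bullet> w0) - f w0"
    using lower[of s0] sup_le[of s0] \<kappa> by simp
  have "GDERIV \<phi> s0 :> - w0"
    unfolding gderiv_def has_derivative_at_alt
  proof (intro conjI allI impI)
    show "bounded_linear (\<lambda>h. h \<bullet> - w0)"
      by (rule bounded_linear_inner_left)
    fix e :: real assume e: "0 < e"
    show "\<exists>d>0. \<forall>s. norm (s - s0) < d \<longrightarrow>
        norm (\<phi> s - \<phi> s0 - (s - s0) \<bullet> - w0) \<le> e * norm (s - s0)"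
    \<comment> \<open>The first bound keeps \<open>s\<close> where the growth dominates, the second makes \<open>2 * D / \<kappa>\<close> at most \<open>e\<close>.\<close>
    proof (intro exI[of _ "min (\<kappa> / 2) (\<kappa> * e / 2)"] conjI allI impI)
      show "0 < min (\<kappa> / 2) (\<kappa> * e / 2)"
        using e \<kappa> by simp
      fix s assume s: "norm (s - s0) < min (\<kappa> / 2) (\<kappa> * e / 2)"
      then have near: "norm (s - s0) \<le> \<kappa> / 2" by simp
      have "\<phi> s - \<phi> s0 - (s - s0) \<bullet> - w0 = \<phi> s - (- (s \<bullet> w0) - f w0)"
        unfolding attained by (simp add: inner_diff_left)
      then have "norm (\<phi> s - \<phi> s0 - (s - s0) \<bullet> - w0) \<le> 2 * (norm (s - s0))\<^sup>2 / \<kappa>"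
        using lower[OF near] sup_le[OF near] by simp
      also have "\<dots> = (2 * norm (s - s0) / \<kappa>) * norm (s - s0)"
        by (simp add: power2_eq_square)
      also have "\<dots> \<le> e * norm (s - s0)"
        using s \<kappa> by (intro mult_right_mono) (auto simp: field_simps)
      finally show "norm (\<phi> s - \<phi> s0 - (s - s0) \<bullet> - w0) \<le> e * norm (s - s0)" .
    qed
  qed
  moreover have "D = - w0" if "GDERIV \<phi> s0 :> D" for D
  proof -
    have "(\<lambda>h. h \<bullet> D) = (\<lambda>h. h \<bullet> - w0)"
      using that \<open>GDERIV \<phi> s0 :> - w0\<close> unfolding gderiv_def by (rule has_derivative_unique)
    then show ?thesis
      by (metis vector_eq_ldot)
  qed
  ultimately show ?thesis
    unfolding conj_grad_def gradient_def \<phi>_def by (rule the_equality)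
qed

section \<open>Strict minimisers for the barrier of the maximal row norm\<close>

text \<open>A common model for both cones. Rows in \<open>\<real>\<close> give the infinity norm barrier; rows in
  \<open>real^'n\<close> give a function that bounds the spectral norm barrier from below after a rotation.\<close>
definition row_norm_barrier :: "real \<times> ('b::real_inner^'m) \<Rightarrow> real" where
  "row_norm_barrier = (\<lambda>(u, X).
     - (\<Sum>i\<in>UNIV. ln (u\<^sup>2 - (norm (X $ i))\<^sup>2)) + (real CARD('m) - 1) * ln u)"

text \<open>The equation is the stationarity condition in the scalar variable \<open>u\<close> of the barrier
  problem, written in \<open>t = 1 / u\<close>, after the rows have been eliminated. The left side is increasing in
  \<open>t > 0\<close>, and its value at \<open>0\<close> is below \<open>p\<close> precisely in the interior of the dual cone.\<close>
lemma stationarity_root_exists: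
  fixes \<rho> :: "'i::finite \<Rightarrow> real"
  assumes "\<And>i. 0 \<le> \<rho> i" "sum \<rho> UNIV < p"
  obtains t where "0 < t" "t + (\<Sum>i\<in>UNIV. sqrt (t\<^sup>2 + (\<rho> i)\<^sup>2)) = p"
proof -
  let ?h = "\<lambda>t. t + (\<Sum>i\<in>UNIV. sqrt (t\<^sup>2 + (\<rho> i)\<^sup>2))"
  have h0: "?h 0 = sum \<rho> UNIV"
    using assms(1) by simp
  have "0 \<le> sum \<rho> UNIV"
    using assms(1) by (simp add: sum_nonneg)
  then have p: "0 \<le> p" using assms(2) by linarith
  have "p \<le> ?h p"
    using p by (simp add: sum_nonneg)
  then obtain t where t: "0 \<le> t" "t \<le> p" "?h t = p"
    using IVT'[of ?h 0 p p] h0 assms(2) p by (fastforce intro!: continuous_intros)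
  moreover have "t \<noteq> 0"
    using t(3) h0 assms(2) by auto
  ultimately show ?thesis using that[of t] by auto
qed

text \<open>Writing \<open>ln s\<close> as \<open>2 * ln (sqrt s)\<close> before using concavity leaves the square
  \<open>(sqrt s - 1)\<^sup>2\<close>, which captures the quadratic growth near \<open>1\<close> and the linear growth at infinity at
  once.\<close>
lemma half_square_growth_le_minus_ln:
  fixes s :: real
  assumes "0 < s"
  shows "(s - 1)\<^sup>2 / (2 * (s + 1)) \<le> s - 1 - ln s"
proof -
  have sq: "sqrt s ^ 2 = s" using assms by simp
  have "ln s = 2 * ln (sqrt s)"
    using assms by (simp add: ln_sqrt)
  also have "\<dots> \<le> 2 * (sqrt s - 1)"
    using ln_le_minus_one[of "sqrt s"] assms by simp
  finally have "(sqrt s - 1)\<^sup>2 \<le> s - 1 - ln s"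
    using sq by (simp add: power2_diff)
  moreover have "(s - 1)\<^sup>2 / (2 * (s + 1)) \<le> (sqrt s - 1)\<^sup>2"
  proof -
    have "(s - 1)\<^sup>2 = (sqrt s - 1)\<^sup>2 * (sqrt s + 1)\<^sup>2"
    proof -
      have "s - 1 = (sqrt s - 1) * (sqrt s + 1)"
        using sq by (simp add: algebra_simps power2_eq_square)
      then show ?thesis by (metis power_mult_distrib)
    qed
    also have "\<dots> \<le> (sqrt s - 1)\<^sup>2 * (2 * (s + 1))"
    proof (intro mult_left_mono)
      have "0 \<le> (sqrt s - 1)\<^sup>2" by simp
      then show "(sqrt s + 1)\<^sup>2 \<le> 2 * (s + 1)"
        using sq by (simp add: power2_sum power2_diff)
    qed simp
    finally show ?thesis using assms by (simp add: pos_divide_le_eq)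
  qed
  ultimately show ?thesis by linarith
qed

text \<open>One row of the barrier, in the homogenised form \<open>u - (norm z)\<^sup>2 / u\<close>. The logarithm is bounded
  by its tangent at the value \<open>2 / (t + q)\<close> taken at the minimiser, and the quadratic-over-linear term is
  split into its linear part and an exact remainder. The remainder measures the distance of \<open>z\<close> from the
  ray through the minimiser; the linear part cancels against the pairing with \<open>r\<close>.\<close>
lemma row_log_bound:
  fixes r z :: "'b::real_inner"
  assumes t: "0 < t" and u: "0 < u" and z: "norm z < u"
  defines "q \<equiv> sqrt (t\<^sup>2 + (norm r)\<^sup>2)"
  shows "ln ((u\<^sup>2 - (norm z)\<^sup>2) / u) \<le>
    ln (2 / (t + q)) - 1 + u * q + r \<bullet> z - t * (norm (z + (u / (t + q)) *\<^sub>R r))\<^sup>2 / u"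
proof -
  have q2: "q\<^sup>2 = t\<^sup>2 + (norm r)\<^sup>2" and qt: "t \<le> q"
    unfolding q_def by (simp_all add: real_le_rsqrt)
  define y where "y = (norm (z + (u / (t + q)) *\<^sub>R r))\<^sup>2"
  have pos: "0 < t + q" using t qt by linarith
  have "(norm z)\<^sup>2 < u\<^sup>2" using z by (simp add: power2_strict_mono)
  then have c: "0 < (u\<^sup>2 - (norm z)\<^sup>2) / u" using u by simp
  have y_eq: "y = (norm z)\<^sup>2 + 2 * (u / (t + q)) * (r \<bullet> z) + (u / (t + q))\<^sup>2 * (norm r)\<^sup>2"
    unfolding y_def power2_norm_eq_inner
    by (simp add: inner_add_left inner_add_right inner_commute power2_eq_square)
  have "ln ((u\<^sup>2 - (norm z)\<^sup>2) / u) - ln (2 / (t + q)) = ln ((u\<^sup>2 - (norm z)\<^sup>2) / u / (2 / (t + q)))"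
    using c pos by (subst ln_div) auto
  also have "\<dots> \<le> (u\<^sup>2 - (norm z)\<^sup>2) / u / (2 / (t + q)) - 1"
    using divide_pos_pos[OF c, of "2 / (t + q)"] pos by (intro ln_le_minus_one) simp
  also have "(u\<^sup>2 - (norm z)\<^sup>2) / u / (2 / (t + q)) = u * q + r \<bullet> z - (t + q) / 2 * y / u"
  proof -
    have r2: "(norm r)\<^sup>2 = (q - t) * (q + t)" using q2 by (simp add: algebra_simps power2_eq_square)
    have "(u / (t + q))\<^sup>2 * (norm r)\<^sup>2 = u\<^sup>2 * (q - t) / (t + q)"
    proof -
      have "(u / D)\<^sup>2 * (a * D) = u\<^sup>2 * a / D" if "0 < D" for a D
        using that by (simp add: power2_eq_square)
      from this[OF pos, of "q - t"] show ?thesis by (simp only: r2 add.commute)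
    qed
    then have "(t + q) * y = (t + q) * (norm z)\<^sup>2 + 2 * u * (r \<bullet> z) + u\<^sup>2 * (q - t)"
      unfolding y_eq using pos by (simp only: distrib_left) simp
    then have "(t + q) / 2 * y / u = ((t + q) * (norm z)\<^sup>2 + 2 * u * (r \<bullet> z) + u\<^sup>2 * (q - t)) / (2 * u)"
      by simp
    also have "\<dots> = u * q + r \<bullet> z - (u\<^sup>2 - (norm z)\<^sup>2) / u / (2 / (t + q))"
      using u pos by (simp add: field_simps power2_eq_square)
    finally show ?thesis by simp
  qed
  finally have "ln ((u\<^sup>2 - (norm z)\<^sup>2) / u) \<le> ln (2 / (t + q)) - 1 + u * q + r \<bullet> z - (t + q) / 2 * y / u"
    by simp
  moreover have "t * y / u \<le> (t + q) / 2 * y / u"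
    using u qt by (intro divide_right_mono mult_right_mono) (auto simp: y_def)
  ultimately show ?thesis unfolding y_def by linarith
qed


text \<open>The point with scalar part \<open>u = 1 / t\<close> at which each row solves the stationarity condition
  \<open>r\<^sub>i + 2 x\<^sub>i / (u\<^sup>2 - (norm x\<^sub>i)\<^sup>2) = 0\<close>, a quadratic equation for the length of a negative multiple of
  \<open>r\<^sub>i\<close>. The factor in front of \<open>r\<^sub>i\<close> depends on \<open>r\<^sub>i\<close> only through its norm; this is what transfers the
  minimiser from the vector of singular values to the matrix.\<close>
definition row_norm_minimiser :: "real \<Rightarrow> ('b::real_inner^'m) \<Rightarrow> real \<times> ('b^'m)" where
  "row_norm_minimiser t r =
     (1 / t, \<chi> i. - (1 / (t * (t + sqrt (t\<^sup>2 + (norm (r $ i))\<^sup>2)))) *\<^sub>R r $ i)"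

lemma norm_vec_squared: "(norm (X :: 'b::real_inner^'m))\<^sup>2 = (\<Sum>i\<in>UNIV. (norm (X $ i))\<^sup>2)"
  by (simp add: power2_norm_eq_inner inner_vec_def)

text \<open>Of the \<open>m\<close> logarithms of \<open>u\<close> released by dividing each argument by \<open>u\<close>, the term
  \<open>(m - 1) * ln u\<close> of the barrier absorbs all but one. In this form the barrier is visibly convex.\<close>
lemma row_norm_barrier_alt:
  fixes X :: "'b::real_inner^'m"
  assumes "0 < u" "\<And>i. norm (X $ i) < u"
  shows "row_norm_barrier (u, X) =
    - (\<Sum>i\<in>UNIV. ln ((u\<^sup>2 - (norm (X $ i))\<^sup>2) / u)) - ln u"
proof -
  have "0 < u\<^sup>2 - (norm (X $ i))\<^sup>2" for i
    using assms(2)[of i] by (simp add: power2_strict_mono)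
  then have "ln ((u\<^sup>2 - (norm (X $ i))\<^sup>2) / u) = ln (u\<^sup>2 - (norm (X $ i))\<^sup>2) - ln u" for i
    using assms(1) by (subst ln_div) auto
  then show ?thesis
    by (simp only: sum_subtractf row_norm_barrier_def prod.case) (simp add: algebra_simps)
qed

lemma norm_row_norm_minimiser:
  assumes "0 < t"
  shows "norm (snd (row_norm_minimiser t r) $ i) < fst (row_norm_minimiser t r)"
proof -
  let ?q = "sqrt (t\<^sup>2 + (norm (r $ i))\<^sup>2)"
  have "norm (r $ i) \<le> ?q" by (simp add: real_le_rsqrt)
  then have "norm (r $ i) < t + ?q" "0 < t + ?q" using assms by (linarith, smt (verit) norm_ge_zero)
  then show ?thesis
    using assms by (simp add: row_norm_minimiser_def divide_simps)
qed

lemma row_norm_barrier_at_minimiser: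
  fixes r :: "'b::real_inner^'m"
  assumes t: "0 < t" and p: "t + (\<Sum>i\<in>UNIV. sqrt (t\<^sup>2 + (norm (r $ i))\<^sup>2)) = p"
  shows "(p, r) \<bullet> row_norm_minimiser t r + row_norm_barrier (row_norm_minimiser t r) =
    1 + ln t + (\<Sum>i\<in>UNIV. 1 - ln (2 / (t + sqrt (t\<^sup>2 + (norm (r $ i))\<^sup>2))))"
proof -
  define q where "q i = sqrt (t\<^sup>2 + (norm (r $ i))\<^sup>2)" for i
  define X where "X = snd (row_norm_minimiser t r)"
  have min: "row_norm_minimiser t r = (1 / t, X)"
    unfolding X_def by (simp add: row_norm_minimiser_def)
  have Xi: "X $ i = - (1 / (t * (t + q i))) *\<^sub>R r $ i" for i
    unfolding X_def q_def by (simp add: row_norm_minimiser_def)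
  have lt: "norm (X $ i) < 1 / t" for i
    using norm_row_norm_minimiser[OF t, of r i] min by simp
  have q2: "(norm (r $ i))\<^sup>2 = (q i - t) * (q i + t)" and qt: "t \<le> q i" for i
    unfolding q_def by (simp_all add: real_le_rsqrt algebra_simps flip: power2_eq_square)
  have pos: "0 < t + q i" for i using qt[of i] t by linarith
  have cancel: "(1 / (t * D))\<^sup>2 * (a * D) = a / (t\<^sup>2 * D)" if "0 < D" for a D
    using that by (simp add: power2_eq_square)
  have "((1 / t)\<^sup>2 - (norm (X $ i))\<^sup>2) / (1 / t) = 2 / (t + q i)" for i
  proof -
    have "(norm (X $ i))\<^sup>2 = (q i - t) / (t\<^sup>2 * (t + q i))"
    proof -
      have "(norm (X $ i))\<^sup>2 = (1 / (t * (t + q i)))\<^sup>2 * (norm (r $ i))\<^sup>2"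
        by (simp add: Xi power_divide)
      also have "\<dots> = (q i - t) / (t\<^sup>2 * (t + q i))"
        using cancel[of "t + q i" "q i - t"] pos[of i] by (simp add: q2 add.commute)
      finally show ?thesis .
    qed
    moreover have "((1 / t)\<^sup>2 - (D - 2 * t) / (t\<^sup>2 * D)) / (1 / t) = 2 / D" if "0 < D" for D
      using that t by (simp add: diff_divide_distrib power2_eq_square)
    from this[OF pos[of i]] have "((1 / t)\<^sup>2 - (q i - t) / (t\<^sup>2 * (t + q i))) / (1 / t) = 2 / (t + q i)"
      by simp
    ultimately show ?thesis by simp
  qed
  then have bar: "row_norm_barrier (1 / t, X) = - (\<Sum>i\<in>UNIV. ln (2 / (t + q i))) + ln t"
    using t by (subst row_norm_barrier_alt) (auto simp: lt ln_div)
  have "r $ i \<bullet> X $ i = 1 - q i / t" for i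
  proof -
    have "r $ i \<bullet> X $ i = - (((q i - t) * (q i + t)) / (t * (q i + t)))"
      by (simp add: Xi dot_square_norm q2 add.commute)
    also have "\<dots> = - ((q i - t) / t)"
      using pos[of i] by simp
    also have "\<dots> = 1 - q i / t"
      using t by (simp add: diff_divide_distrib)
    finally show ?thesis .
  qed
  then have "r \<bullet> X = (\<Sum>i\<in>UNIV. 1 - q i / t)"
    by (simp add: inner_vec_def)
  moreover have "p / t = 1 + (\<Sum>i\<in>UNIV. q i / t)"
    using t p by (simp add: q_def sum_divide_distrib[symmetric] divide_simps)
  ultimately have "p * (1 / t) + r \<bullet> X = 1 + (\<Sum>i\<in>(UNIV :: 'm set). 1)"
    by (simp add: sum_subtractf)
  then show ?thesis
    unfolding min bar by (simp add: q_def sum_subtractf)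
qed

text \<open>The surplus splits into a term that controls \<open>u\<close> and a term that controls the distance of \<open>X\<close>
  from the multiple of the minimiser lying at height \<open>u\<close>; together they force uniqueness.\<close>
lemma row_norm_barrier_lower_bound:
  fixes r X :: "'b::real_inner^'m"
  assumes t: "0 < t" and p: "t + (\<Sum>i\<in>UNIV. sqrt (t\<^sup>2 + (norm (r $ i))\<^sup>2)) = p"
    and u: "0 < u" and X: "\<And>i. norm (X $ i) < u"
  shows "(p, r) \<bullet> row_norm_minimiser t r + row_norm_barrier (row_norm_minimiser t r)
      + (t * u - 1 - ln (t * u))
      + t * (norm (X - (t * u) *\<^sub>R snd (row_norm_minimiser t r)))\<^sup>2 / u
    \<le> (p, r) \<bullet> (u, X) + row_norm_barrier (u, X)"
proof -
  define q where "q i = sqrt (t\<^sup>2 + (norm (r $ i))\<^sup>2)" for i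
  define Y where "Y = X - (t * u) *\<^sub>R snd (row_norm_minimiser t r)"
  have Yi: "Y $ i = X $ i + (u / (t + q i)) *\<^sub>R r $ i" for i
    unfolding Y_def q_def using t by (simp add: row_norm_minimiser_def)
  have "(\<Sum>i\<in>UNIV. ln ((u\<^sup>2 - (norm (X $ i))\<^sup>2) / u)) \<le>
    (\<Sum>i\<in>UNIV. ln (2 / (t + q i)) - 1 + u * q i + r $ i \<bullet> X $ i - t * (norm (Y $ i))\<^sup>2 / u)"
    unfolding Yi q_def using t u X by (intro sum_mono row_log_bound) auto
  also have "\<dots> = (\<Sum>i\<in>UNIV. ln (2 / (t + q i)) - 1) + u * (\<Sum>i\<in>UNIV. q i) + r \<bullet> X
      - t * (norm Y)\<^sup>2 / u"
    by (simp add: sum.distrib sum_subtractf inner_vec_def norm_vec_squared[of Y]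
        sum_distrib_left sum_divide_distrib)
  also have "(\<Sum>i\<in>UNIV. q i) = p - t"
    using p by (simp add: q_def)
  finally have "(\<Sum>i\<in>UNIV. ln ((u\<^sup>2 - (norm (X $ i))\<^sup>2) / u)) \<le>
    - (\<Sum>i\<in>UNIV. 1 - ln (2 / (t + q i))) + u * (p - t) + r \<bullet> X - t * (norm Y)\<^sup>2 / u"
    by (simp add: sum_subtractf)
  moreover have "ln (t * u) = ln t + ln u"
    using t u by (simp add: ln_mult)
  ultimately show ?thesis
    unfolding row_norm_barrier_at_minimiser[OF t p] row_norm_barrier_alt[OF u X] Y_def[symmetric]
    by (simp add: q_def algebra_simps)
qed

text \<open>The surplus above, converted to the distance from the minimiser. The constant \<open>C\<close> pays for
  replacing the moving target \<open>(t * u) *\<^sub>R snd w0\<close> by \<open>snd w0\<close>, and \<open>t + 2\<close> for replacing the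
  denominator \<open>t * u + 1\<close> by \<open>1\<close> plus the distance.\<close>
lemma row_norm_barrier_growth:
  fixes r :: "'b::real_inner^'m"
  assumes t: "0 < t" and p: "t + (\<Sum>i\<in>UNIV. sqrt (t\<^sup>2 + (norm (r $ i))\<^sup>2)) = p"
  defines "w0 \<equiv> row_norm_minimiser t r"
  shows "\<exists>\<kappa>>0. \<forall>u X. 0 < u \<longrightarrow> (\<forall>i. norm (X $ i) < u) \<longrightarrow>
      (p, r) \<bullet> w0 + row_norm_barrier w0
        + \<kappa> * (norm ((u, X) - w0))\<^sup>2 / (1 + norm ((u, X) - w0))
      \<le> (p, r) \<bullet> (u, X) + row_norm_barrier (u, X)"
proof -
  define \<Xi> where "\<Xi> = t *\<^sub>R snd w0"
  define C where "C = 1 + 2 * (norm \<Xi>)\<^sup>2"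
  have C: "1 \<le> C" by (simp add: C_def)
  define \<kappa> where "\<kappa> = t\<^sup>2 / (2 * C * (t + 2))"
  have "0 < \<kappa>" using t C by (simp add: \<kappa>_def)
  moreover have "(p, r) \<bullet> w0 + row_norm_barrier w0
        + \<kappa> * (norm ((u, X) - w0))\<^sup>2 / (1 + norm ((u, X) - w0))
      \<le> (p, r) \<bullet> (u, X) + row_norm_barrier (u, X)"
    if u: "0 < u" and X: "\<And>i. norm (X $ i) < u" for u and X :: "'b^'m"
  proof -
    define s where "s = t * u"
    have s: "0 < s" using t u by (simp add: s_def)
    define d where "d = norm (X - s *\<^sub>R snd w0)"
    define N where "N = norm ((u, X) - w0)"
    have w0: "w0 = (1 / t, snd w0)" by (simp add: w0_def row_norm_minimiser_def)
    have N2: "N\<^sup>2 = (u - 1 / t)\<^sup>2 + (norm (X - snd w0))\<^sup>2"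
      unfolding N_def by (subst w0) (simp add: norm_Pair)
    have sm: "s - 1 = t * (u - 1 / t)" using t by (simp add: s_def algebra_simps)
    have N0: "0 \<le> N" by (simp add: N_def)
    have "(u - 1 / t)\<^sup>2 \<le> N\<^sup>2"
      unfolding N2 by simp
    then have "\<bar>u - 1 / t\<bar> \<le> N"
      using N0 by (simp only: abs_le_square_iff[symmetric])
    then have "t * (u - 1 / t) \<le> t * N" using t by (intro mult_left_mono) linarith+
    then have s_le: "s + 1 \<le> (t + 2) * (1 + N)"
      using sm t N0 by (simp add: algebra_simps)
    have dev: "(norm (X - snd w0))\<^sup>2 \<le> 2 * d\<^sup>2 + 2 * ((u - 1 / t)\<^sup>2 * (norm \<Xi>)\<^sup>2)"
    proof -
      have "X - snd w0 = (X - s *\<^sub>R snd w0) + (u - 1 / t) *\<^sub>R \<Xi>"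
        using t unfolding \<Xi>_def s_def by (simp add: algebra_simps)
      then have "norm (X - snd w0) \<le> d + \<bar>u - 1 / t\<bar> * norm \<Xi>"
        unfolding d_def by (metis norm_triangle_ineq norm_scaleR)
      then have "(norm (X - snd w0))\<^sup>2 \<le> (d + \<bar>u - 1 / t\<bar> * norm \<Xi>)\<^sup>2"
        by (intro power_mono) auto
      also have "\<dots> \<le> 2 * d\<^sup>2 + 2 * (\<bar>u - 1 / t\<bar> * norm \<Xi>)\<^sup>2"
        using zero_le_power2[of "d - \<bar>u - 1 / t\<bar> * norm \<Xi>"] by (simp add: power2_sum power2_diff)
      finally show ?thesis by (simp add: power_mult_distrib)
    qed
    have "t\<^sup>2 / (2 * C) * N\<^sup>2 \<le> t\<^sup>2 / (2 * C) * (C * (u - 1 / t)\<^sup>2 + 2 * d\<^sup>2)"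
      using dev C t by (intro mult_left_mono) (simp_all add: N2 C_def algebra_simps)
    also have "\<dots> = (s - 1)\<^sup>2 / 2 + t\<^sup>2 * d\<^sup>2 / C"
      using C unfolding sm by (simp add: field_simps)
    also have "\<dots> \<le> (s - 1)\<^sup>2 / 2 + t\<^sup>2 * d\<^sup>2"
      using C by (simp add: divide_le_eq mult_left_mono[of 1 C "t\<^sup>2 * d\<^sup>2", simplified])
    finally have "t\<^sup>2 / (2 * C) * N\<^sup>2 \<le> (s - 1)\<^sup>2 / 2 + t\<^sup>2 * d\<^sup>2" .
    then have "t\<^sup>2 / (2 * C) * N\<^sup>2 / (s + 1) \<le> ((s - 1)\<^sup>2 / 2 + t\<^sup>2 * d\<^sup>2) / (s + 1)"
      using s by (intro divide_right_mono) auto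
    moreover have "\<kappa> * N\<^sup>2 / (1 + N) \<le> t\<^sup>2 / (2 * C) * N\<^sup>2 / (s + 1)"
    proof -
      have "\<kappa> * N\<^sup>2 / (1 + N) = t\<^sup>2 / (2 * C) * N\<^sup>2 / ((t + 2) * (1 + N))"
        by (simp add: \<kappa>_def)
      also have "\<dots> \<le> t\<^sup>2 / (2 * C) * N\<^sup>2 / (s + 1)"
        using s_le s C by (intro divide_left_mono) auto
      finally show ?thesis .
    qed
    moreover have "((s - 1)\<^sup>2 / 2 + t\<^sup>2 * d\<^sup>2) / (s + 1) \<le> (s - 1 - ln s) + t * d\<^sup>2 / u"
    proof -
      have "((s - 1)\<^sup>2 / 2 + t\<^sup>2 * d\<^sup>2) / (s + 1) = (s - 1)\<^sup>2 / (2 * (s + 1)) + t\<^sup>2 * d\<^sup>2 / (s + 1)"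
        by (simp add: add_divide_distrib)
      moreover have "t\<^sup>2 * d\<^sup>2 / (s + 1) \<le> t\<^sup>2 * d\<^sup>2 / s"
        using s by (intro divide_left_mono) auto
      moreover have "t\<^sup>2 * d\<^sup>2 / s = t * d\<^sup>2 / u"
        using t by (simp add: s_def power2_eq_square)
      ultimately show ?thesis
        using half_square_growth_le_minus_ln[OF s] by linarith
    qed
    ultimately have "\<kappa> * N\<^sup>2 / (1 + N) \<le> (s - 1 - ln s) + t * d\<^sup>2 / u"
      by linarith
    then show ?thesis
      using row_norm_barrier_lower_bound[OF t p u X]
      unfolding N_def d_def s_def w0_def by linarith
  qed
  ultimately show ?thesis by blast
qed

section \<open>Existence of thin singular value decompositions\<close>

lemma quadratic_nonpos_imp_linear_coeff_zero:
  fixes k l :: real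
  assumes "\<And>t. k * t + l * t\<^sup>2 \<le> 0"
  shows "k = 0"
proof (rule ccontr)
  assume k: "k \<noteq> 0"
  let ?a = "\<bar>l\<bar> + 1"
  have "k * (k / ?a) + l * (k / ?a)\<^sup>2 = k\<^sup>2 * (?a + l) / ?a\<^sup>2"
    by (simp add: divide_simps power2_eq_square) (simp add: algebra_simps)
  moreover have "0 < k\<^sup>2 * (?a + l) / ?a\<^sup>2"
    using k by (intro divide_pos_pos mult_pos_pos) auto
  ultimately show False
    using assms[of "k / ?a"] by linarith
qed

definition orthonormal_frame :: "('i \<Rightarrow> 'a::real_inner) \<Rightarrow> bool" where
  "orthonormal_frame v \<longleftrightarrow> (\<forall>k l. v k \<bullet> v l = of_bool (k = l))"

text \<open>Take a frame that maximises the squared norms of the images, weighted by pairwise distinct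
  numbers. It exists because the frames form a compact set. Rotating two of its vectors by an angle with
  tangent \<open>t\<close> changes the objective, up to a positive factor, by a quadratic in \<open>t\<close> whose linear coefficient
  is the difference of the two weights times twice the inner product of the two images. At a maximum this
  coefficient vanishes. Equal weights would make the objective rotation invariant.\<close>
lemma orthogonal_frame_with_orthogonal_images:
  fixes T :: "real^'m \<Rightarrow> 'b::real_inner"
  assumes T: "linear T"
  obtains Y :: "real^'m^'m" where "orthonormal_frame (($) Y)"
    "\<And>k l. k \<noteq> l \<Longrightarrow> T (Y $ k) \<bullet> T (Y $ l) = 0"
proof -
  define G where "G = {Y :: real^'m^'m. orthonormal_frame (($) Y)}"
  obtain e :: "'m \<Rightarrow> nat" where e: "inj e"
    using finite_imp_inj_to_nat_seg[of "UNIV :: 'm set"] by auto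
  define \<Phi> where "\<Phi> Y = (\<Sum>i\<in>UNIV. real (e i) * (norm (T (Y $ i)))\<^sup>2)" for Y :: "real^'m^'m"
  have "closed G"
    unfolding G_def orthonormal_frame_def
    by (intro closed_Collect_all closed_Collect_eq continuous_intros)
  moreover have "bounded G"
  proof (rule boundedI)
    fix Y assume "Y \<in> G"
    then have "Y \<bullet> Y = real CARD('m)"
      unfolding G_def orthonormal_frame_def by (simp add: inner_vec_def[of Y Y])
    then show "norm Y \<le> sqrt (real CARD('m))"
      by (simp add: norm_eq_sqrt_inner)
  qed
  ultimately have "compact G" by (simp add: compact_eq_bounded_closed)
  moreover have "mat 1 \<in> G"
  proof -
    have "(mat 1 :: real^'m^'m) $ k = axis k 1" for k
      by (simp add: vec_eq_iff mat_def axis_def eq_commute)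
    then show ?thesis
      unfolding G_def orthonormal_frame_def by (simp add: inner_axis_axis)
  qed
  moreover have "continuous_on G \<Phi>"
  proof -
    have "bounded_linear T" using T by (simp add: linear_conv_bounded_linear)
    then have "continuous_on G (\<lambda>Y. T (Y $ i))" for i
      by (rule bounded_linear.continuous_on) (intro continuous_intros)
    then show ?thesis unfolding \<Phi>_def by (intro continuous_intros)
  qed
  ultimately obtain Y where Y: "Y \<in> G" and max: "\<And>Z. Z \<in> G \<Longrightarrow> \<Phi> Z \<le> \<Phi> Y"
    using continuous_attains_sup[of G \<Phi>] by blast
  have ortho: "Y $ k \<bullet> Y $ l = of_bool (k = l)" for k l
    using Y unfolding G_def orthonormal_frame_def by blast
  have "T (Y $ i) \<bullet> T (Y $ j) = 0" if ij: "i \<noteq> j" for i j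
  proof -
    define x y where "x = T (Y $ i)" and "y = T (Y $ j)"
    have "(real (e i) - real (e j)) * (2 * (x \<bullet> y)) = 0"
    proof (rule quadratic_nonpos_imp_linear_coeff_zero)
      fix t :: real
      \<comment> \<open>The cosine and the sine of the angle with tangent \<open>t\<close>.\<close>
      define c s where "c = 1 / sqrt (1 + t\<^sup>2)" and "s = t * c"
      have pos: "0 < 1 + t\<^sup>2" by (smt (verit) zero_le_power2)
      have c2: "c\<^sup>2 = 1 / (1 + t\<^sup>2)"
        unfolding c_def using pos by (simp add: power_divide)
      have cs: "c * c + s * s = 1"
      proof -
        have "c * c + s * s = c\<^sup>2 * (1 + t\<^sup>2)"
          unfolding s_def by (simp add: algebra_simps power2_eq_square)
        then show ?thesis using c2 pos by simp
      qed
      define Z :: "real^'m^'m" where "Z = (\<chi> k. if k = i then c *\<^sub>R Y $ i + s *\<^sub>R Y $ j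
          else if k = j then (- s) *\<^sub>R Y $ i + c *\<^sub>R Y $ j else Y $ k)"
      have Zi: "Z $ i = c *\<^sub>R Y $ i + s *\<^sub>R Y $ j"
        and Zj: "Z $ j = (- s) *\<^sub>R Y $ i + c *\<^sub>R Y $ j"
        and Zk: "\<And>k. k \<noteq> i \<Longrightarrow> k \<noteq> j \<Longrightarrow> Z $ k = Y $ k"
        using ij by (auto simp: Z_def)
      have "Z $ k \<bullet> Z $ l = of_bool (k = l)" for k l
        using ij cs
        by (cases "k = i"; cases "k = j"; cases "l = i"; cases "l = j")
           (auto simp: Zi Zj Zk inner_add_left inner_add_right inner_diff_left inner_diff_right ortho algebra_simps)
      then have "Z \<in> G" unfolding G_def orthonormal_frame_def by blast
      then have "\<Phi> Z \<le> \<Phi> Y" by (rule max)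
      moreover have split: "\<Phi> M = real (e i) * (norm (T (M $ i)))\<^sup>2 + (real (e j) * (norm (T (M $ j)))\<^sup>2
          + (\<Sum>k\<in>UNIV - {i} - {j}. real (e k) * (norm (T (M $ k)))\<^sup>2))" for M
        unfolding \<Phi>_def using ij
        by (subst sum.remove[of _ i], simp, simp, subst sum.remove[of _ j]) auto
      moreover have "(\<Sum>k\<in>UNIV - {i} - {j}. real (e k) * (norm (T (Z $ k)))\<^sup>2)
          = (\<Sum>k\<in>UNIV - {i} - {j}. real (e k) * (norm (T (Y $ k)))\<^sup>2)"
        by (intro sum.cong) (auto simp: Zk)
      moreover have TZ: "T (Z $ i) = c *\<^sub>R x + s *\<^sub>R y" "T (Z $ j) = (- s) *\<^sub>R x + c *\<^sub>R y"
        unfolding Zi Zj x_def y_def by (simp_all only: linear_add[OF T] linear_scale[OF T])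
      moreover have "(norm (c *\<^sub>R x + s *\<^sub>R y))\<^sup>2 = c\<^sup>2 * (norm x)\<^sup>2 + 2 * c * s * (x \<bullet> y) + s\<^sup>2 * (norm y)\<^sup>2"
        "(norm ((- s) *\<^sub>R x + c *\<^sub>R y))\<^sup>2 = s\<^sup>2 * (norm x)\<^sup>2 - 2 * c * s * (x \<bullet> y) + c\<^sup>2 * (norm y)\<^sup>2"
        unfolding power2_norm_eq_inner
        by (simp_all add: inner_add_left inner_add_right inner_diff_left inner_diff_right inner_commute algebra_simps power2_eq_square)
      ultimately have "real (e i) * (c\<^sup>2 * (norm x)\<^sup>2 + 2 * c * s * (x \<bullet> y) + s\<^sup>2 * (norm y)\<^sup>2)
          + real (e j) * (s\<^sup>2 * (norm x)\<^sup>2 - 2 * c * s * (x \<bullet> y) + c\<^sup>2 * (norm y)\<^sup>2)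
        \<le> real (e i) * (norm x)\<^sup>2 + real (e j) * (norm y)\<^sup>2"
        unfolding x_def y_def by simp
      also have "\<dots> = real (e i) * ((c\<^sup>2 + s\<^sup>2) * (norm x)\<^sup>2) + real (e j) * ((c\<^sup>2 + s\<^sup>2) * (norm y)\<^sup>2)"
        using cs by (simp add: power2_eq_square)
      finally have "(real (e i) - real (e j)) * (2 * c * s * (x \<bullet> y) + s\<^sup>2 * ((norm y)\<^sup>2 - (norm x)\<^sup>2)) \<le> 0"
        by (simp add: algebra_simps)
      then have "c\<^sup>2 * ((real (e i) - real (e j)) * (2 * (x \<bullet> y)) * t
          + (real (e i) - real (e j)) * ((norm y)\<^sup>2 - (norm x)\<^sup>2) * t\<^sup>2) \<le> 0"
        unfolding s_def by (simp add: algebra_simps power2_eq_square)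
      then show "(real (e i) - real (e j)) * (2 * (x \<bullet> y)) * t
          + (real (e i) - real (e j)) * ((norm y)\<^sup>2 - (norm x)\<^sup>2) * t\<^sup>2 \<le> 0"
        using c2 pos by (simp add: mult_le_0_iff divide_le_0_iff)
    qed
    moreover have "e i \<noteq> e j" using e ij by (auto dest: injD)
    ultimately show ?thesis unfolding x_def y_def by simp
  qed
  then show ?thesis
    using that[of Y] Y unfolding G_def by blast
qed

text \<open>Nonzero members are rescaled. The indices of zero members receive, one at a time, unit vectors
  orthogonal to those already chosen, which exist as long as fewer than \<open>DIM('a)\<close> are in use.\<close>
lemma orthogonal_family_normalise:
  fixes x :: "'i::finite \<Rightarrow> 'a::euclidean_space"
  assumes card: "CARD('i) \<le> DIM('a)"
    and ortho: "\<And>k l. k \<noteq> l \<Longrightarrow> x k \<bullet> x l = 0"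
  obtains v where "orthonormal_frame v" "\<And>k. x k = norm (x k) *\<^sub>R v k"
proof -
  let ?S = "{k. x k \<noteq> 0}"
  have "\<exists>v. (\<forall>k\<in>?S \<union> A. \<forall>l\<in>?S \<union> A. v k \<bullet> v l = of_bool (k = l)) \<and> (\<forall>k. x k = norm (x k) *\<^sub>R v k)"
    for A :: "'i set"
    using finite[of A]
  proof (induction A rule: finite_induct)
    case empty
    show ?case
    proof (intro exI[of _ "\<lambda>k. x k /\<^sub>R norm (x k)"] conjI ballI allI)
      fix k l assume "k \<in> ?S \<union> {}" "l \<in> ?S \<union> {}"
      then show "(x k /\<^sub>R norm (x k)) \<bullet> (x l /\<^sub>R norm (x l)) = of_bool (k = l)"
        using ortho[of k l] by (cases "k = l") (auto simp: dot_square_norm power2_eq_square)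
    next
      fix k show "x k = norm (x k) *\<^sub>R (x k /\<^sub>R norm (x k))"
        by (cases "x k = 0") auto
    qed
  next
    case (insert a A)
    then obtain v where v: "\<And>k l. k \<in> ?S \<union> A \<Longrightarrow> l \<in> ?S \<union> A \<Longrightarrow> v k \<bullet> v l = of_bool (k = l)"
      and xv: "\<And>k. x k = norm (x k) *\<^sub>R v k"
      by blast
    show ?case
    proof (cases "a \<in> ?S")
      case True
      then have "?S \<union> insert a A = ?S \<union> A" by auto
      then show ?thesis using v xv by (intro exI[of _ v]) metis
    next
      case False
      have "dim (v ` (?S \<union> A)) \<le> card (v ` (?S \<union> A))"
        by (intro dim_le_card) (auto simp: span_superset)
      also have "\<dots> \<le> card (?S \<union> A)" by (intro card_image_le) simp
      also have "\<dots> < CARD('i)"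
        using False insert.hyps by (intro psubset_card_mono) auto
      finally have "dim (v ` (?S \<union> A)) < DIM('a)" using card by linarith
      then obtain w where w: "w \<noteq> 0" "\<And>y. y \<in> span (v ` (?S \<union> A)) \<Longrightarrow> orthogonal w y"
        using orthogonal_to_subspace_exists by blast
      define b where "b = w /\<^sub>R norm w"
      have bb: "b \<bullet> b = 1" using w(1) by (simp add: b_def dot_square_norm power2_eq_square)
      have bv: "b \<bullet> v k = 0" if "k \<in> ?S \<union> A" for k
        using w(2)[of "v k"] that by (simp add: b_def orthogonal_def span_base)
      show ?thesis
      proof (intro exI[of _ "v(a := b)"] conjI ballI allI)
        fix k l assume "k \<in> ?S \<union> insert a A" "l \<in> ?S \<union> insert a A"
        then show "(v(a := b)) k \<bullet> (v(a := b)) l = of_bool (k = l)"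
          using v[of k l] bv[of k] bv[of l] bb by (auto simp: inner_commute)
      next
        fix k show "x k = norm (x k) *\<^sub>R (v(a := b)) k"
          using xv[of k] False by auto
      qed
    qed
  qed
  from this[of UNIV] show ?thesis using that unfolding orthonormal_frame_def by auto
qed

lemma thin_rows_orthonormal:
  fixes V :: "real^'m^'n"
  shows "transpose V ** V = mat 1 \<longleftrightarrow> orthonormal_frame (($) (transpose V))"
  by (simp add: vec_eq_iff matrix_matrix_mult_def mat_def transpose_def orthonormal_frame_def
      inner_vec_def of_bool_def)

lemma orthogonal_matrix_rows:
  fixes Q :: "real^'m^'m"
  shows "orthogonal_matrix Q \<longleftrightarrow> orthonormal_frame (($) Q)"
  using thin_rows_orthonormal[of "transpose Q"] orthogonal_matrix[of "transpose Q"]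
  by (simp add: transpose_transpose orthogonal_matrix_transpose)

lemma matrix_mult_row:
  fixes A :: "real^'k^'m" and B :: "real^'n^'k"
  shows "(A ** B) $ i = (\<Sum>j\<in>UNIV. A $ i $ j *\<^sub>R B $ j)"
  by (simp add: vec_eq_iff matrix_matrix_mult_def)

lemma diag_mat_mult_row:
  fixes B :: "real^'n^'m"
  shows "(diag_mat s ** B) $ i = s $ i *\<^sub>R B $ i"
  by (simp add: vec_eq_iff matrix_matrix_mult_def diag_mat_def if_distrib[of "\<lambda>x. x * _"] cong: if_cong)

lemma inner_matrix_mult_left:
  fixes A :: "real^'k^'m" and B :: "real^'n^'k" and C :: "real^'n^'m"
  shows "(A ** B) \<bullet> C = B \<bullet> (transpose A ** C)"
proof -
  have "(A ** B) \<bullet> C = (\<Sum>i\<in>UNIV. \<Sum>k\<in>UNIV. A $ i $ k * (B $ k \<bullet> C $ i))"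
    by (simp add: inner_vec_def[of _ C] matrix_mult_row inner_sum_left)
  also have "\<dots> = (\<Sum>k\<in>UNIV. \<Sum>i\<in>UNIV. A $ i $ k * (B $ k \<bullet> C $ i))"
    by (rule sum.swap)
  also have "\<dots> = B \<bullet> (transpose A ** C)"
    by (simp add: inner_vec_def[of B] matrix_mult_row inner_sum_right transpose_def)
  finally show ?thesis .
qed

lemma norm_orthogonal_matrix_mult:
  fixes Q :: "real^'m^'m" and A :: "real^'n^'m"
  assumes "orthogonal_matrix Q"
  shows "norm (Q ** A) = norm A"
  using assms
  by (simp add: norm_eq_sqrt_inner inner_matrix_mult_left matrix_mul_assoc orthogonal_matrix_def)

text \<open>Once the rows of \<open>Y ** W\<close> are orthogonal, their norms are the singular values and their
  directions are the columns of \<open>V\<close>.\<close>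
lemma thin_svd_exists:
  fixes W :: "real^'n^'m"
  assumes "CARD('m) \<le> CARD('n)"
  obtains U s V where "thin_svd W U s V"
proof -
  have "linear (\<lambda>y. y v* W)"
    by (simp add: linear_iff vec_eq_iff vector_matrix_mult_def algebra_simps sum.distrib sum_distrib_left)
  then obtain Y :: "real^'m^'m" where Y: "orthonormal_frame (($) Y)"
    and img: "\<And>k l. k \<noteq> l \<Longrightarrow> (Y $ k v* W) \<bullet> (Y $ l v* W) = 0"
    using orthogonal_frame_with_orthogonal_images by blast
  have row: "(Y ** W) $ k = Y $ k v* W" for k
    by (simp add: vec_eq_iff matrix_matrix_mult_def vector_matrix_mult_def mult.commute)
  obtain v where v: "orthonormal_frame v" "\<And>k. (Y ** W) $ k = norm ((Y ** W) $ k) *\<^sub>R v k"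
    using orthogonal_family_normalise[of "($) (Y ** W)"] img assms unfolding row by auto
  define s where "s = (\<chi> k. norm ((Y ** W) $ k))"
  define V where "V = transpose (\<chi> k. v k)"
  have "orthonormal_frame (($) (transpose V))"
    using v(1) by (simp add: V_def transpose_transpose orthonormal_frame_def)
  moreover have orth: "orthogonal_matrix Y" using Y by (simp add: orthogonal_matrix_rows)
  moreover have "Y ** W = diag_mat s ** transpose V"
    by (subst vec_eq_iff) (auto simp: diag_mat_mult_row s_def V_def transpose_transpose simp flip: v(2))
  then have "W = transpose Y ** diag_mat s ** transpose V"
    using orth by (metis matrix_mul_assoc matrix_mul_lid orthogonal_matrix)
  ultimately have "thin_svd W (transpose Y) s V"
    by (simp add: thin_svd_def thin_rows_orthonormal s_def orthogonal_matrix_transpose)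
  then show ?thesis by (rule that)
qed

section \<open>Singular values and the rows of a rotated matrix\<close>

text \<open>A singular value decomposition whose diagonal may have any signs. The matrix part of the
  minimiser has the singular vectors of \<open>R\<close> but a nonpositive diagonal, so it fits this relation and not
  \<^const>\<open>thin_svd\<close>.\<close>
definition diagonalises :: "real^'n^'m \<Rightarrow> real^'m^'m \<Rightarrow> real^'m \<Rightarrow> real^'m^'n \<Rightarrow> bool" where
  "diagonalises W U s V \<longleftrightarrow> orthogonal_matrix U \<and> orthonormal_frame (($) (transpose V)) \<and>
     transpose U ** W = diag_mat s ** transpose V"

lemma diagonalisesI:
  assumes "orthogonal_matrix U" "transpose V ** V = mat 1" "W = U ** diag_mat s ** transpose V"
  shows "diagonalises W U s V"
proof -
  have "transpose U ** W = (transpose U ** U) ** (diag_mat s ** transpose V)"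
    unfolding assms(3) by (simp only: matrix_mul_assoc)
  then show ?thesis
    using assms(1,2) unfolding diagonalises_def thin_rows_orthonormal[symmetric]
    by (simp add: orthogonal_matrix matrix_mul_lid)
qed

lemma thin_svd_diagonalises: "thin_svd W U s V \<Longrightarrow> diagonalises W U s V"
  unfolding thin_svd_def by (blast intro: diagonalisesI)

lemma diagonalises_singular_values:
  fixes W :: "real^'n^'m"
  assumes "CARD('m) \<le> CARD('n)"
  obtains U V where "diagonalises W U (singular_values W) V" "\<And>i. 0 \<le> singular_values W $ i"
proof -
  have "\<exists>s U V. thin_svd W U s V" using thin_svd_exists[OF assms, of W] by metis
  then have "\<exists>U V. thin_svd W U (singular_values W) V"
    unfolding singular_values_def by (rule someI_ex)
  then show ?thesis using that thin_svd_diagonalises unfolding thin_svd_def by blast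
qed

lemma norm_row_diagonalised:
  assumes "diagonalises W U s V"
  shows "norm ((transpose U ** W) $ i) = \<bar>s $ i\<bar>"
proof -
  have "norm (transpose V $ i) = 1"
    using assms by (simp add: diagonalises_def orthonormal_frame_def norm_eq_1)
  then show ?thesis
    using assms by (simp add: diagonalises_def diag_mat_mult_row)
qed

text \<open>By the orthonormality of the rows of \<open>transpose V\<close>, the squared row norms of a rotated matrix
  arise from the squared singular values through the squared entries of an orthogonal matrix. These are
  doubly stochastic weights.\<close>
lemma norm_row_rotated:
  assumes diag: "diagonalises W U' s V"
  shows "(norm ((transpose U ** W) $ i))\<^sup>2 =
    (\<Sum>j\<in>UNIV. ((transpose U ** U') $ i $ j)\<^sup>2 * (s $ j)\<^sup>2)"
proof -
  define Q where "Q = transpose U ** U'"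
  let ?v = "($) (transpose V)"
  have v: "?v j \<bullet> ?v k = of_bool (j = k)" for j k
    using diag by (simp add: diagonalises_def orthonormal_frame_def)
  have "transpose U ** W = Q ** (transpose U' ** W)"
    using diag unfolding Q_def diagonalises_def orthogonal_matrix_def
    by (metis matrix_mul_assoc matrix_mul_lid)
  also have "\<dots> = Q ** (diag_mat s ** transpose V)"
    using diag by (simp add: diagonalises_def)
  finally have "(transpose U ** W) $ i = (\<Sum>j\<in>UNIV. (Q $ i $ j * s $ j) *\<^sub>R ?v j)"
    by (simp add: matrix_mult_row[of Q] diag_mat_mult_row)
  then have "(norm ((transpose U ** W) $ i))\<^sup>2 =
      (\<Sum>j\<in>UNIV. \<Sum>k\<in>UNIV. (Q $ i $ j * s $ j) * ((Q $ i $ k * s $ k) * (?v k \<bullet> ?v j)))"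
    unfolding power2_norm_eq_inner by (simp add: inner_sum_left inner_sum_right sum_distrib_left mult_ac)
  also have "\<dots> = (\<Sum>j\<in>UNIV. (Q $ i $ j * s $ j)\<^sup>2)"
    unfolding v by (simp add: of_bool_def if_distrib power2_eq_square cong: if_cong)
  finally show ?thesis by (simp add: Q_def power_mult_distrib)
qed

lemma orthogonal_matrix_squares:
  fixes Q :: "real^'m^'m"
  assumes "orthogonal_matrix Q"
  shows "(\<Sum>j\<in>UNIV. (Q $ i $ j)\<^sup>2) = 1" "(\<Sum>j\<in>UNIV. (Q $ j $ i)\<^sup>2) = 1"
proof -
  have *: "(\<Sum>j\<in>UNIV. (P $ i $ j)\<^sup>2) = 1" if "orthogonal_matrix P" for P :: "real^'m^'m"
    using that by (simp add: orthogonal_matrix_rows orthonormal_frame_def inner_vec_def power2_eq_square)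
  show "(\<Sum>j\<in>UNIV. (Q $ i $ j)\<^sup>2) = 1" by (rule *[OF assms])
  show "(\<Sum>j\<in>UNIV. (Q $ j $ i)\<^sup>2) = 1"
    using *[of "transpose Q"] assms unfolding orthogonal_matrix_transpose by (simp add: transpose_def)
qed

lemma norm_row_rotated_le:
  assumes diag: "diagonalises W U' s V" and U: "orthogonal_matrix U"
    and b: "\<And>j. \<bar>s $ j\<bar> \<le> b"
  shows "norm ((transpose U ** W) $ i) \<le> b"
proof (rule power2_le_imp_le)
  have Q: "orthogonal_matrix (transpose U ** U')"
    using diag U by (simp add: diagonalises_def orthogonal_matrix_mul orthogonal_matrix_transpose)
  have "(s $ j)\<^sup>2 \<le> b\<^sup>2" for j
    using power_mono[OF b[of j] abs_ge_zero, of 2] by simp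
  then have "(norm ((transpose U ** W) $ i))\<^sup>2 \<le>
      (\<Sum>j\<in>UNIV. ((transpose U ** U') $ i $ j)\<^sup>2 * b\<^sup>2)"
    unfolding norm_row_rotated[OF diag] by (intro sum_mono mult_left_mono) auto
  also have "\<dots> = b\<^sup>2"
    using orthogonal_matrix_squares(1)[OF Q] by (simp flip: sum_distrib_right)
  finally show "(norm ((transpose U ** W) $ i))\<^sup>2 \<le> b\<^sup>2" .
  show "0 \<le> b" using b[of i] by linarith
qed

lemma norm_row_rotated_less:
  fixes s :: "real^'m"
  assumes "diagonalises W U' s V" "orthogonal_matrix U" "\<And>j. \<bar>s $ j\<bar> < u"
  shows "norm ((transpose U ** W) $ i) < u"
proof -
  let ?b = "Max (range (\<lambda>j. \<bar>s $ j\<bar>))"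
  have "norm ((transpose U ** W) $ i) \<le> ?b"
    using assms(1,2) by (rule norm_row_rotated_le) simp
  also have "?b < u" using assms(3) by simp
  finally show ?thesis .
qed

lemma linf_barrier_eq_row_norm_barrier:
  assumes "\<And>i. norm (X $ i) = \<bar>s $ i\<bar>"
  shows "linf_barrier (u, s) = row_norm_barrier (u, X)"
  unfolding linf_barrier_def row_norm_barrier_def by (simp add: assms)

text \<open>Jensen's inequality for the concave logarithm along each row of the doubly stochastic weights; in
  the sum over the rows each singular value then has total weight one. This plays the part of Hadamard's
  determinant inequality and of the trace inequality for singular values.\<close>
lemma row_norm_barrier_rotated_le:
  fixes s :: "real^'m"
  assumes diag: "diagonalises W U' s V" and U: "orthogonal_matrix U"
    and s: "\<And>j. \<bar>s $ j\<bar> < u"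
  shows "row_norm_barrier (u, transpose U ** W) \<le> linf_barrier (u, s)"
proof -
  let ?Q = "transpose U ** U'"
  have Q: "orthogonal_matrix ?Q"
    using diag U by (simp add: diagonalises_def orthogonal_matrix_mul orthogonal_matrix_transpose)
  have pos: "0 < u\<^sup>2 - (s $ j)\<^sup>2" for j
    using power_strict_mono[OF s[of j] abs_ge_zero, of 2] by simp
  have "(\<Sum>j\<in>UNIV. (?Q $ i $ j)\<^sup>2 * ln (u\<^sup>2 - (s $ j)\<^sup>2)) \<le>
      ln (u\<^sup>2 - (norm ((transpose U ** W) $ i))\<^sup>2)" for i
  proof -
    have "(\<Sum>j\<in>UNIV. (?Q $ i $ j)\<^sup>2 * ln (u\<^sup>2 - (s $ j)\<^sup>2)) \<le>
        ln (\<Sum>j\<in>UNIV. (?Q $ i $ j)\<^sup>2 *\<^sub>R (u\<^sup>2 - (s $ j)\<^sup>2))"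
      using orthogonal_matrix_squares(1)[OF Q, of i] pos
      by (intro concave_on_sum[OF _ _ ln_concave]) auto
    also have "(\<Sum>j\<in>UNIV. (?Q $ i $ j)\<^sup>2 *\<^sub>R (u\<^sup>2 - (s $ j)\<^sup>2)) =
        u\<^sup>2 - (norm ((transpose U ** W) $ i))\<^sup>2"
      using orthogonal_matrix_squares(1)[OF Q, of i]
      by (simp add: norm_row_rotated[OF diag] right_diff_distrib sum_subtractf flip: sum_distrib_right)
    finally show ?thesis .
  qed
  then have "(\<Sum>i\<in>UNIV. \<Sum>j\<in>UNIV. (?Q $ i $ j)\<^sup>2 * ln (u\<^sup>2 - (s $ j)\<^sup>2)) \<le>
      (\<Sum>i\<in>UNIV. ln (u\<^sup>2 - (norm ((transpose U ** W) $ i))\<^sup>2))"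
    by (rule sum_mono)
  also have "(\<Sum>i\<in>UNIV. \<Sum>j\<in>UNIV. (?Q $ i $ j)\<^sup>2 * ln (u\<^sup>2 - (s $ j)\<^sup>2)) =
      (\<Sum>j\<in>UNIV. ln (u\<^sup>2 - (s $ j)\<^sup>2))"
    by (subst sum.swap) (simp add: orthogonal_matrix_squares(2)[OF Q] flip: sum_distrib_right)
  finally show ?thesis
    unfolding linf_barrier_def row_norm_barrier_def by simp
qed

section \<open>The interiors of the cones and the spectral norm barrier\<close>

lemma max_singular_value_le_iff:
  fixes W :: "real^'n^'m"
  shows "max_singular_value W \<le> b \<longleftrightarrow> (\<forall>i. singular_values W $ i \<le> b)"
  unfolding max_singular_value_def by (subst Max_le_iff) auto

lemma max_singular_value_le:
  fixes W :: "real^'n^'m"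
  assumes card: "CARD('m) \<le> CARD('n)" and rows: "\<And>U i. orthogonal_matrix U \<Longrightarrow> norm ((transpose U ** W) $ i) \<le> b"
  shows "max_singular_value W \<le> b"
proof -
  obtain U V where diag: "diagonalises W U (singular_values W) V"
    by (rule diagonalises_singular_values[OF card])
  then have "orthogonal_matrix U" by (simp add: diagonalises_def)
  then show ?thesis
    unfolding max_singular_value_le_iff
    using rows norm_row_diagonalised[OF diag] by (metis abs_le_D1)
qed

lemma interior_shift_fst:
  fixes K :: "(real \<times> 'a::real_normed_vector) set"
  assumes "(u, w) \<in> interior K"
  obtains e where "0 < e" "(u - e, w) \<in> K"
proof -
  obtain d where d: "0 < d" "ball (u, w) d \<subseteq> K"
    using assms by (auto simp: mem_interior)
  have "(u - d / 2, w) \<in> ball (u, w) d"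
    using d(1) by (simp add: dist_Pair_Pair dist_real_def)
  then show ?thesis using that[of "d / 2"] d by auto
qed

lemma abs_singular_values_less:
  fixes W :: "real^'n^'m"
  assumes card: "CARD('m) \<le> CARD('n)" and int: "(u, W) \<in> interior spec_cone"
  shows "\<bar>singular_values W $ i\<bar> < u"
proof -
  obtain e where "0 < e" "max_singular_value W \<le> u - e"
    using interior_shift_fst[OF int] by (auto simp: spec_cone_def)
  moreover have "0 \<le> singular_values W $ i" for i
    using diagonalises_singular_values[OF card, of W] by metis
  ultimately show ?thesis unfolding max_singular_value_le_iff by (smt (verit))
qed

text \<open>A perturbation \<open>D\<close> of the matrix changes every row norm of every rotated copy by at most the
  Frobenius norm of \<open>D\<close>, hence the largest singular value by no more than that.\<close>
lemma interior_spec_coneI: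
  fixes W :: "real^'n^'m"
  assumes card: "CARD('m) \<le> CARD('n)" and diag: "diagonalises W U s V" and s: "\<And>j. \<bar>s $ j\<bar> < u"
  shows "(u, W) \<in> interior spec_cone"
proof -
  define b where "b = Max (range (\<lambda>j. \<bar>s $ j\<bar>))"
  have b: "\<bar>s $ j\<bar> \<le> b" for j unfolding b_def by simp
  have bu: "b < u" unfolding b_def using s by simp
  have "ball (u, W) ((u - b) / 2) \<subseteq> spec_cone"
  proof
    fix x assume x: "x \<in> ball (u, W) ((u - b) / 2)"
    obtain u' W' where x_eq: "x = (u', W')" by fastforce
    have "dist u u' < (u - b) / 2" "dist W W' < (u - b) / 2"
      using x dist_fst_le[of "(u, W)" x] dist_snd_le[of "(u, W)" x] unfolding x_eq by auto
    then have u': "u - (u - b) / 2 < u'" and W': "norm (W' - W) < (u - b) / 2"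
      unfolding dist_real_def dist_norm norm_minus_commute[of W W'] by linarith+
    have "max_singular_value W' \<le> u'"
    proof (rule max_singular_value_le[OF card])
      fix Q :: "real^'m^'m" and i
      assume Q: "orthogonal_matrix Q"
      have "transpose Q ** W' = transpose Q ** W + transpose Q ** (W' - W)"
        by (simp flip: matrix_add_ldistrib)
      then have "norm ((transpose Q ** W') $ i) \<le>
          norm ((transpose Q ** W) $ i) + norm ((transpose Q ** (W' - W)) $ i)"
        by (simp add: norm_triangle_ineq)
      also have "\<dots> \<le> b + norm (transpose Q ** (W' - W))"
        using norm_row_rotated_le[OF diag Q b] by (intro add_mono Finite_Cartesian_Product.norm_nth_le)
      also have "norm (transpose Q ** (W' - W)) = norm (W' - W)"
        using Q by (simp add: norm_orthogonal_matrix_mult orthogonal_matrix_transpose)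
      finally show "norm ((transpose Q ** W') $ i) \<le> u'"
        using u' W' by (simp add: field_simps)
    qed
    then show "x \<in> spec_cone" by (simp add: x_eq spec_cone_def)
  qed
  then show ?thesis using bu by (auto simp: mem_interior intro!: exI[of _ "(u - b) / 2"])
qed

lemma interior_linf_cone_iff:
  fixes w :: "real^'m"
  shows "(u, w) \<in> interior linf_cone \<longleftrightarrow> (\<forall>i. \<bar>w $ i\<bar> < u)"
proof
  assume "(u, w) \<in> interior linf_cone"
  then obtain e where "0 < e" "infnorm w \<le> u - e"
    by (rule interior_shift_fst) (auto simp: linf_cone_def)
  then have "\<bar>w $ i\<bar> < u" for i
    using component_le_infnorm_cart[of w i] by linarith
  then show "\<forall>i. \<bar>w $ i\<bar> < u" ..
next
  assume w: "\<forall>i. \<bar>w $ i\<bar> < u"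
  let ?I = "{x :: real \<times> (real^'m). infnorm (snd x) < fst x}"
  have "open ?I"
    by (intro open_Collect_less continuous_intros continuous_on_infnorm)
  moreover have "?I \<subseteq> linf_cone"
    by (auto simp: linf_cone_def)
  ultimately have "?I \<subseteq> interior linf_cone"
    by (intro interior_maximal)
  moreover have "infnorm w < u"
    unfolding infnorm_Max using w by (subst Max_less_iff) (auto simp: Basis_vec_def inner_axis)
  ultimately show "(u, w) \<in> interior linf_cone"
    by auto
qed

lemma row_norm_barrier_le_spec_barrier:
  fixes W :: "real^'n^'m"
  assumes card: "CARD('m) \<le> CARD('n)" and U: "orthogonal_matrix U"
    and int: "(u, W) \<in> interior spec_cone"
  shows "row_norm_barrier (u, transpose U ** W) \<le> spec_barrier (u, W)"
proof -
  obtain U' V' where "diagonalises W U' (singular_values W) V'"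
    by (rule diagonalises_singular_values[OF card])
  from row_norm_barrier_rotated_le[OF this U abs_singular_values_less[OF card int]]
  show ?thesis by (simp add: spec_barrier_def)
qed

text \<open>The barrier is evaluated at singular values picked by a choice operator. Two diagonalisations of
  the same matrix bound each other's barrier through \<open>row_norm_barrier_rotated_le\<close>, so any of them
  gives the same value.\<close>
lemma spec_barrier_eq_row_norm_barrier:
  fixes W :: "real^'n^'m"
  assumes card: "CARD('m) \<le> CARD('n)" and diag: "diagonalises W U s V" and s: "\<And>j. \<bar>s $ j\<bar> < u"
  shows "spec_barrier (u, W) = row_norm_barrier (u, transpose U ** W)"
proof (rule antisym)
  have U: "orthogonal_matrix U" using diag by (simp add: diagonalises_def)
  show "row_norm_barrier (u, transpose U ** W) \<le> spec_barrier (u, W)"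
    by (rule row_norm_barrier_le_spec_barrier[OF card U interior_spec_coneI[OF card diag s]])
  obtain U' V' where diag': "diagonalises W U' (singular_values W) V'"
    by (rule diagonalises_singular_values[OF card])
  then have U': "orthogonal_matrix U'" by (simp add: diagonalises_def)
  have "spec_barrier (u, W) = row_norm_barrier (u, transpose U' ** W)"
    unfolding spec_barrier_def
    by (simp add: linf_barrier_eq_row_norm_barrier[OF norm_row_diagonalised[OF diag']])
  also have "\<dots> \<le> linf_barrier (u, s)"
    by (rule row_norm_barrier_rotated_le[OF diag U' s])
  also have "\<dots> = row_norm_barrier (u, transpose U ** W)"
    by (rule linf_barrier_eq_row_norm_barrier[OF norm_row_diagonalised[OF diag]])
  finally show "spec_barrier (u, W) \<le> row_norm_barrier (u, transpose U ** W)" .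
qed

text \<open>The sum of the singular values is minus the pairing of \<open>R\<close> with \<open>- (U ** transpose V)\<close>, a matrix
  whose singular values are all one.\<close>
lemma sum_singular_values_less:
  fixes R :: "real^'n^'m" and sigma :: "real^'m"
  assumes card: "CARD('m) \<le> CARD('n)"
    and int: "(p, R) \<in> interior (dual_cone (spec_cone :: (real \<times> (real^'n^'m)) set))"
    and svd: "thin_svd R U sigma V"
  shows "(\<Sum>i\<in>UNIV. sigma $ i) < p"
proof -
  have U: "orthogonal_matrix U" and V: "transpose V ** V = mat 1"
    using svd by (auto simp: thin_svd_def)
  have diag: "diagonalises R U sigma V" using svd by (rule thin_svd_diagonalises)
  define W where "W = U ** diag_mat (\<chi> i. - 1) ** transpose V"
  have dW: "diagonalises W U (\<chi> i. - 1) V"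
    using U V W_def by (rule diagonalisesI)
  have "max_singular_value W \<le> 1"
    using norm_row_rotated_le[OF dW] by (intro max_singular_value_le[OF card]) auto
  then have mem: "(1, W) \<in> spec_cone" by (simp add: spec_cone_def)
  obtain e where e: "0 < e" "(p - e, R) \<in> dual_cone (spec_cone :: (real \<times> (real^'n^'m)) set)"
    by (rule interior_shift_fst[OF int])
  then have "0 \<le> p - e + W \<bullet> R"
    using mem by (force simp: dual_cone_def)
  moreover have "W \<bullet> R = (diag_mat (\<chi> i. - 1) ** transpose V) \<bullet> (diag_mat sigma ** transpose V)"
    using diag unfolding W_def diagonalises_def by (simp add: inner_matrix_mult_left flip: matrix_mul_assoc)
  moreover have "\<dots> = - (\<Sum>i\<in>UNIV. sigma $ i)"
    using V unfolding thin_rows_orthonormal orthonormal_frame_def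
    by (simp add: inner_vec_def[of "_ ** _"] diag_mat_mult_row sum_negf)
  ultimately show ?thesis using e(1) by linarith
qed

section \<open>The conjugate gradient of the spectral norm cone\<close>

theorem proposition3p7:
  fixes p :: real and R :: "real^'n^'m"
    and U :: "real^'m^'m" and sigma :: "real^'m" and V :: "real^'m^'n"
  assumes "CARD('m) \<le> CARD('n)"
    and "(p, R) \<in> interior (dual_cone (spec_cone :: (real \<times> (real^'n^'m)) set))"
    and "thin_svd R U sigma V"
  shows "fst (conj_grad spec_cone spec_barrier (p, R))
           = fst (conj_grad linf_cone linf_barrier (p, sigma)) \<and>
         snd (conj_grad spec_cone spec_barrier (p, R))
           = U ** diag_mat (snd (conj_grad linf_cone linf_barrier (p, sigma))) ** transpose V"
proof -
  have U: "orthogonal_matrix U" and V: "transpose V ** V = mat 1" and sigma: "\<And>i. 0 \<le> sigma $ i"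
    using assms(3) by (auto simp: thin_svd_def)
  have R: "diagonalises R U sigma V" using assms(3) by (rule thin_svd_diagonalises)
  define r where "r = transpose U ** R"
  have norm_r: "norm (r $ i) = norm (sigma $ i)" for i
    unfolding r_def by (simp add: norm_row_diagonalised[OF R])
  obtain t where t: "0 < t" and tp: "t + (\<Sum>i\<in>UNIV. sqrt (t\<^sup>2 + (sigma $ i)\<^sup>2)) = p"
    using stationarity_root_exists[of "($) sigma" p] sigma sum_singular_values_less[OF assms] by blast
  define w where "w = snd (row_norm_minimiser t sigma)"
  have min_sigma: "row_norm_minimiser t sigma = (1 / t, w)"
    unfolding w_def by (simp add: row_norm_minimiser_def)
  have w: "\<bar>w $ i\<bar> < 1 / t" for i
    using norm_row_norm_minimiser[OF t, of sigma i] by (simp add: min_sigma)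

  have "conj_grad linf_cone linf_barrier (p, sigma) = - (1 / t, w)"
  proof -
    have ts: "t + (\<Sum>i\<in>UNIV. sqrt (t\<^sup>2 + (norm (sigma $ i))\<^sup>2)) = p"
      using tp by simp
    obtain \<kappa> where \<kappa>: "0 < \<kappa>" and growth: "\<forall>u X. 0 < u \<longrightarrow> (\<forall>i. norm (X $ i) < u) \<longrightarrow>
        (p, sigma) \<bullet> (1 / t, w) + row_norm_barrier (1 / t, w)
          + \<kappa> * (norm ((u, X) - (1 / t, w)))\<^sup>2 / (1 + norm ((u, X) - (1 / t, w)))
        \<le> (p, sigma) \<bullet> (u, X) + row_norm_barrier (u, X)"
      using row_norm_barrier_growth[OF t ts] unfolding min_sigma by (elim exE conjE)
    have same: "linf_barrier x = row_norm_barrier x" for x :: "real \<times> (real^'m)"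
      using linf_barrier_eq_row_norm_barrier[of "snd x" "snd x" "fst x"] by simp
    show ?thesis
    proof (rule conj_grad_eq_uminus_minimiser[OF _ \<kappa>])
      show "(1 / t, w) \<in> interior linf_cone"
        using w by (simp add: interior_linf_cone_iff)
      fix x :: "real \<times> (real^'m)" assume x: "x \<in> interior linf_cone"
      obtain u X where x_eq: "x = (u, X)" by fastforce
      have lt: "\<bar>X $ i\<bar> < u" for i using x by (simp add: x_eq interior_linf_cone_iff)
      have "0 < u" using lt[of undefined] by linarith
      then show "(p, sigma) \<bullet> (1 / t, w) + linf_barrier (1 / t, w)
          + \<kappa> * (norm (x - (1 / t, w)))\<^sup>2 / (1 + norm (x - (1 / t, w)))
        \<le> (p, sigma) \<bullet> x + linf_barrier x"
        unfolding same x_eq by (intro growth[rule_format]) (simp_all add: lt)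
    qed
  qed
  moreover have "conj_grad spec_cone spec_barrier (p, R) = - (1 / t, U ** diag_mat w ** transpose V)"
  proof -
    define X0 where "X0 = diag_mat w ** transpose V"
    define W0 where "W0 = U ** diag_mat w ** transpose V"
    have dW0: "diagonalises W0 U w V" using U V W0_def by (rule diagonalisesI)
    then have X0: "transpose U ** W0 = X0" by (simp add: diagonalises_def X0_def)
    have min_r: "row_norm_minimiser t r = (1 / t, X0)"
    proof -
      have "r $ i = sigma $ i *\<^sub>R transpose V $ i" for i
        using R by (simp add: r_def diagonalises_def diag_mat_mult_row)
      then have "snd (row_norm_minimiser t r) $ i = X0 $ i" for i
        unfolding row_norm_minimiser_def norm_r
        by (simp add: X0_def diag_mat_mult_row w_def row_norm_minimiser_def)
      then have "snd (row_norm_minimiser t r) = X0" by (simp only: vec_eq_iff) blast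
      moreover have "fst (row_norm_minimiser t r) = 1 / t" by (simp add: row_norm_minimiser_def)
      ultimately show ?thesis by (simp only: prod_eq_iff fst_conv snd_conv simp_thms)
    qed
    have tr: "t + (\<Sum>i\<in>UNIV. sqrt (t\<^sup>2 + (norm (r $ i))\<^sup>2)) = p"
      using tp by (simp add: norm_r)
    obtain \<kappa> where \<kappa>: "0 < \<kappa>" and growth: "\<forall>u X. 0 < u \<longrightarrow> (\<forall>i. norm (X $ i) < u) \<longrightarrow>
        (p, r) \<bullet> (1 / t, X0) + row_norm_barrier (1 / t, X0)
          + \<kappa> * (norm ((u, X) - (1 / t, X0)))\<^sup>2 / (1 + norm ((u, X) - (1 / t, X0)))
        \<le> (p, r) \<bullet> (u, X) + row_norm_barrier (u, X)"
      using row_norm_barrier_growth[OF t tr] unfolding min_r by (elim exE conjE)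
    have UU: "orthogonal_matrix (transpose U)" using U by (simp add: orthogonal_matrix_transpose)
    have "R = U ** r"
      unfolding r_def using U by (simp add: matrix_mul_assoc orthogonal_matrix_def)
    then have pairing: "(p, R) \<bullet> (u, W) = (p, r) \<bullet> (u, transpose U ** W)" for u W
      by (simp add: inner_matrix_mult_left)
    have distance: "norm ((u, W) - (1 / t, W0)) = norm ((u, transpose U ** W) - (1 / t, X0))" for u W
    proof -
      have "transpose U ** W = transpose U ** (W - W0) + X0"
        unfolding X0[symmetric] by (simp flip: matrix_add_ldistrib)
      then show ?thesis
        using norm_orthogonal_matrix_mult[OF UU, of "W - W0"] by (simp add: norm_Pair)
    qed
    show ?thesis unfolding W0_def[symmetric]
    proof (rule conj_grad_eq_uminus_minimiser[OF _ \<kappa>])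
      show "(1 / t, W0) \<in> interior spec_cone"
        by (rule interior_spec_coneI[OF assms(1) dW0 w])
      fix x :: "real \<times> (real^'n^'m)" assume x: "x \<in> interior spec_cone"
      obtain u W where x_eq: "x = (u, W)" by fastforce
      obtain U' V' where diag': "diagonalises W U' (singular_values W) V'"
        by (rule diagonalises_singular_values[OF assms(1)])
      have lt: "norm ((transpose U ** W) $ i) < u" for i
        using x unfolding x_eq
        by (intro norm_row_rotated_less[OF diag' U] abs_singular_values_less[OF assms(1)])
      have "0 < u" using lt[of undefined] norm_ge_zero by (rule le_less_trans[rotated])
      from growth[rule_format, OF this lt] have "(p, R) \<bullet> (1 / t, W0) + spec_barrier (1 / t, W0)
          + \<kappa> * (norm (x - (1 / t, W0)))\<^sup>2 / (1 + norm (x - (1 / t, W0)))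
        \<le> (p, R) \<bullet> x + row_norm_barrier (u, transpose U ** W)"
        unfolding x_eq pairing distance spec_barrier_eq_row_norm_barrier[OF assms(1) dW0 w] X0 .
      also have "\<dots> \<le> (p, R) \<bullet> x + spec_barrier x"
        using row_norm_barrier_le_spec_barrier[OF assms(1) U] x unfolding x_eq by simp
      finally show "(p, R) \<bullet> (1 / t, W0) + spec_barrier (1 / t, W0)
          + \<kappa> * (norm (x - (1 / t, W0)))\<^sup>2 / (1 + norm (x - (1 / t, W0)))
        \<le> (p, R) \<bullet> x + spec_barrier x" .
    qed
  qed
  moreover have "diag_mat (- w) = - diag_mat w"
    by (simp add: diag_mat_def vec_eq_iff)
  moreover have "U ** (- D) ** transpose V = - (U ** D ** transpose V)" for D :: "real^'m^'m"
    by (simp add: vec_eq_iff matrix_matrix_mult_def sum_negf)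
  ultimately show ?thesis by simp
qed

end
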